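(* Let $A\in\mathbb{R}^{N\times N}$ be a symmetric positive semidefinite matrix, let $\epsilon>0$, let $y^n=(y^n_1,\dots,y^n_N)^T\in\mathbb{R}^N$, and put $$J_n = 3\operatorname{diag}\left((y_1^n)^2,\dots,(y_N^n)^2\right)-I,\qquad \widehat{A}_n = A\left(J_n+\epsilon^2 A+I\right),\qquad \widehat{g}^n=A\left(J_ny^n+y^n-F'(y^n)\right),$$ where $F'(c)=c(c^2-1)$ is applied elementwise. Then the matrix $\widehat{A}_n$ is diagonalizable and has real nonnegative eigenvalues. Furthermore, there exists a symmetric positive semidefinite matrix $\tilde{A}_n\in\mathbb{R}^{N\times N}$ which is similar to the matrix $\widehat{A}_n$. Therefore, for every $\tau>0$, with $P$ denoting the LIM Chebyshev polynomial associated with $\tau$ and $\widehat{A}_n$, the matrix $P(\widehat{A}_n)$ is similar to the matrix $P(\tilde{A}_n)$ (the same polynomial $P$ evaluated at $\tilde{A}_n$). In addition, for any $\tau>0$ the matrix $I+\tau\widehat{A}_n$ is nonsingular, so that the linearized implicit Euler scheme $$\frac{y^{n+1}-y^n}{\tau}=-\widehat{A}_ny^{n+1}+\widehat{g}^n$$ is solvable for $y^{n+1}$ for any $\tau>0$.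
   Context: Setting: the space-discretized Cahn–Hilliard equation is the initial value problem $y'(t)=-A\left(F'(y(t))+\epsilon^2Ay(t)\right)$, $y(0)=y^0$, where $A\in\mathbb{R}^{N\times N}$ is symmetric positive semidefinite ($-A$ is a Laplacian discretization), $\epsilon>0$ is a parameter, and $F'(c)=c(c^2-1)$ is applied elementwise. The vector $y^n\in\mathbb{R}^N$ is the numerical solution at time step $n$, and $J_n$ is the Jacobian of $y\mapsto F'(y)$ at $y=y^n$. The matrix $\widehat{A}_n$ and vector $\widehat{g}^n$ above arise by linearizing $F'$ at $y^n$ in the implicit Euler scheme with Eyre convex splitting $\frac{y^{n+1}-y^n}{\tau}=-A\left(F'(y^{n+1})+\epsilon^2Ay^{n+1}+y^{n+1}-y^n\right)$. $I$ is the $N\times N$ identity matrix. Matrices $X,Y\in\mathbb{R}^{N\times N}$ are called similar if there exists a nonsingular $C\in\mathbb{R}^{N\times N}$ with $X=CYC^{-1}$. LIM Chebyshev polynomial. One LIM time step with step size $\tau>0$, matrix $\widehat{A}_n$ and vector $\widehat{g}^n\in\mathbb{R}^N$ works as follows. Put $\lambda_{\max}=\|\widehat{A}_n\|_1=\max_j\sum_i|\widehat{a}_{ij}|$ and $$p=\left\lceil\frac{\pi/4}{\pi/2-\arctan\sqrt{\tau\lambda_{\max}}}\right\rceil.$$ Let $\beta_1,\dots,\beta_p$ be an ordering of the numbers $\cos\left(\pi\frac{2i-1}{2p}\right)$, $i=1,\dots,p$, with $\beta_1=\cos(\pi/(2p))$; let $z_1=\beta_1$ and $a_m=\frac{\lambda_{\max}}{1+z_1}(z_1-\beta_m)$,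 $m=1,\dots,p$. Starting from $y^{(\mathrm{prev})}=y^n$, perform successively for $m=1,\dots,p$ and then again for $m=2,\dots,p$ the iterations $$y^{(\mathrm{next})}=\frac{1}{1+\tau a_m}\left(y^n+\tau a_m y^{(\mathrm{prev})}+\tau(\widehat{g}^n-\widehat{A}_ny^{(\mathrm{prev})})\right),\qquad y^{(\mathrm{prev})}:=y^{(\mathrm{next})}.$$ These $2p-1$ iterations combined form the action of a polynomial in $\widehat{A}_n$, namely (with respect to the solution of $(I+\tau\widehat{A}_n)y=y^n+\tau\widehat{g}^n$, the difference is multiplied by $P(\widehat{A}_n)$) the LIM Chebyshev polynomial $$P(x)=\prod_{m=1}^{p}\frac{\tau(a_m-x)}{1+\tau a_m}\;\prod_{m=2}^{p}\frac{\tau(a_m-x)}{1+\tau a_m},$$ where an empty product equals $1$. *)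

theory Defs
  imports "HOL-Analysis.Analysis" "HOL-Computational_Algebra.Polynomial"
begin

definition diag_matrix :: "real ^ 'n \<Rightarrow> real ^ 'n ^ 'n" where
  "diag_matrix d = (\<chi> i j. if i = j then d $ i else 0)"

definition similar_matrix :: "real ^ 'n ^ 'n \<Rightarrow> real ^ 'n ^ 'n \<Rightarrow> bool" where
  "similar_matrix X Y \<longleftrightarrow> (\<exists>C :: real ^ 'n ^ 'n. invertible C \<and> X = C ** Y ** matrix_inv C)"

definition diagonalizable :: "real ^ 'n ^ 'n \<Rightarrow> bool" where
  "diagonalizable M \<longleftrightarrow> (\<exists>d. similar_matrix M (diag_matrix d))"

definition sym_psd :: "real ^ 'n ^ 'n \<Rightarrow> bool" where
  "sym_psd M \<longleftrightarrow> transpose M = M \<and> (\<forall>x. 0 \<le> x \<bullet> (M *v x))"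

(* Eigenvalues are taken over the complex numbers, so that their being real is a
   genuine claim about a real matrix. *)
definition complex_eigenvalue :: "real ^ 'n ^ 'n \<Rightarrow> complex \<Rightarrow> bool" where
  "complex_eigenvalue M z \<longleftrightarrow>
     (\<exists>v :: complex ^ 'n. v \<noteq> 0 \<and> map_matrix complex_of_real M *v v = z *s v)"

(* The product * on the vector type is componentwise, so the power ^ and
   polynomial evaluation with poly are not the matrix notions. *)
primrec matrix_power :: "real ^ 'n ^ 'n \<Rightarrow> nat \<Rightarrow> real ^ 'n ^ 'n" where
  "matrix_power M 0 = mat 1"
| "matrix_power M (Suc k) = M ** matrix_power M k"

definition poly_matrix :: "real poly \<Rightarrow> real ^ 'n ^ 'n \<Rightarrow> real ^ 'n ^ 'n" where
  "poly_matrix P M = (\<Sum>k\<le>degree P. coeff P k *\<^sub>R matrix_power M k)"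

definition norm1_matrix :: "real ^ 'n ^ 'n \<Rightarrow> real" where
  "norm1_matrix M = Max (range (\<lambda>j. \<Sum>i\<in>UNIV. \<bar>M $ i $ j\<bar>))"


subsection \<open>Linearized Cahn--Hilliard step\<close>

definition F' :: "real \<Rightarrow> real" where
  "F' c = c * (c\<^sup>2 - 1)"

definition F'_vec :: "real ^ 'n \<Rightarrow> real ^ 'n" where
  "F'_vec y = (\<chi> i. F' (y $ i))"

definition J_mat :: "real ^ 'n \<Rightarrow> real ^ 'n ^ 'n" where
  "J_mat y = 3 *\<^sub>R diag_matrix (\<chi> i. (y $ i)\<^sup>2) - mat 1"

definition A_hat :: "real ^ 'n ^ 'n \<Rightarrow> real \<Rightarrow> real ^ 'n \<Rightarrow> real ^ 'n ^ 'n" where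
  "A_hat A \<epsilon> y = A ** (J_mat y + \<epsilon>\<^sup>2 *\<^sub>R A + mat 1)"

definition g_hat :: "real ^ 'n ^ 'n \<Rightarrow> real ^ 'n \<Rightarrow> real ^ 'n" where
  "g_hat A y = A *v (J_mat y *v y + y - F'_vec y)"


subsection \<open>LIM Chebyshev polynomial\<close>

definition lim_p :: "real \<Rightarrow> real ^ 'n ^ 'n \<Rightarrow> nat" where
  "lim_p \<tau> M = nat \<lceil>(pi / 4) / (pi / 2 - arctan (sqrt (\<tau> * norm1_matrix M)))\<rceil>"

(* The p Chebyshev nodes are pairwise distinct, so an ordering of them is a bijection
   from the index set {1..p}. *)
definition lim_ordering :: "nat \<Rightarrow> (nat \<Rightarrow> real) \<Rightarrow> bool" where
  "lim_ordering p \<beta> \<longleftrightarrow>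
     bij_betw \<beta> {1..p} ((\<lambda>i. cos (pi * (2 * real i - 1) / (2 * real p))) ` {1..p}) \<and>
     \<beta> 1 = cos (pi / (2 * real p))"

definition lim_a :: "real ^ 'n ^ 'n \<Rightarrow> (nat \<Rightarrow> real) \<Rightarrow> nat \<Rightarrow> real" where
  "lim_a M \<beta> m = norm1_matrix M / (1 + \<beta> 1) * (\<beta> 1 - \<beta> m)"

definition lim_poly :: "real \<Rightarrow> real ^ 'n ^ 'n \<Rightarrow> (nat \<Rightarrow> real) \<Rightarrow> real poly" where
  "lim_poly \<tau> M \<beta> =
     (let p = lim_p \<tau> M; a = lim_a M \<beta>;
          q = (\<lambda>m. smult (\<tau> / (1 + \<tau> * a m)) [:a m, - 1:])
      in (\<Prod>m=1..p. q m) * (\<Prod>m=2..p. q m))"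

lemma poly_lim_poly:
  "poly (lim_poly \<tau> M \<beta>) x =
     (\<Prod>m=1..lim_p \<tau> M. \<tau> * (lim_a M \<beta> m - x) / (1 + \<tau> * lim_a M \<beta> m)) *
     (\<Prod>m=2..lim_p \<tau> M. \<tau> * (lim_a M \<beta> m - x) / (1 + \<tau> * lim_a M \<beta> m))"
  by (simp add: lim_poly_def Let_def poly_prod right_diff_distrib diff_divide_distrib mult.commute)

end

theory Submission
  imports Defs
begin

text \<open>
  Write \<open>B = J\<^sub>n + \<epsilon>\<^sup>2 A + I = 3 diag ((y\<^sup>n\<^sub>i)\<^sup>2) + \<epsilon>\<^sup>2 A\<close>, a symmetric positive semidefinite
  matrix with \<open>A\<^sub>n = A B\<close>. The product \<open>A B\<close> is not symmetric, but it is self-adjoint and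
  nonnegative for the semi-inner product \<open>\<langle>x, y\<rangle> = x \<bullet> B y\<close>, because \<open>B A B\<close> is symmetric
  and positive semidefinite. If \<open>B\<close> were definite, the spectral theorem for this inner product
  would diagonalize \<open>A B\<close> over the reals.

  The matrix \<open>B\<close> may be singular, so that the form degenerates. Here the term \<open>\<epsilon>\<^sup>2 A\<close> helps:
  both summands of \<open>B\<close> are nonnegative forms, so \<open>B x = 0\<close> forces \<open>x \<bullet> A x = 0\<close> and hence
  \<open>A x = 0\<close>. So \<open>ker B \<subseteq> ker A\<close>, and by symmetry the range of \<open>A\<close> is
  orthogonal to \<open>ker B\<close>. The space thus splits into \<open>ker B\<close>, on which \<open>A B\<close> vanishes, and its
  orthogonal complement, which is invariant under \<open>A B\<close> and on which the form is definite. The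
  spectral theorem on the second summand (\<open>definite_subspace_spanned_by_eigenvectors\<close>) shows
  that eigenvectors of \<open>A B\<close> with nonnegative eigenvalues span the whole space
  (\<open>psd_product_eigenvectors_span\<close>).

  Choosing a basis among them gives \<open>A B = C D C\<^sup>-\<^sup>1\<close> with \<open>D\<close> diagonal and nonnegative, and
  \<open>D\<close> itself serves as the symmetric positive semidefinite matrix similar to \<open>A B\<close>.
  The eigenvalues and the invertibility of \<open>I + \<tau> A B\<close> can be read off from \<open>D\<close>, and the claim
  on the LIM Chebyshev polynomial holds because evaluating a polynomial commutes with conjugation.
\<close>


section \<open>Operators that are self-adjoint for a semidefinite form\<close>

text \<open>
  Equality case of the Cauchy--Schwarz inequality for a semi-inner product: moving from \<open>v\<close> in
  a direction \<open>y\<close> with \<open>y \<bullet> L v \<noteq> 0\<close> changes the quadratic form to first order, so it would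
  become negative nearby.
\<close>

lemma semidefinite_null_vector_orthogonal:
  fixes L :: "'a::real_inner \<Rightarrow> 'a"
  assumes L: "linear L" and S: "subspace S"
    and sym: "\<And>x y. x \<in> S \<Longrightarrow> y \<in> S \<Longrightarrow> x \<bullet> L y = y \<bullet> L x"
    and nonneg: "\<And>x. x \<in> S \<Longrightarrow> 0 \<le> x \<bullet> L x"
    and v: "v \<in> S" "v \<bullet> L v = 0" and y: "y \<in> S"
  shows "y \<bullet> L v = 0"
proof -
  define c q where "c = y \<bullet> L v" and "q = y \<bullet> L y"
  have quadratic: "0 \<le> 2 * t * c + t\<^sup>2 * q" for t
  proof -
    have "v + t *\<^sub>R y \<in> S"
      using S v y by (simp add: subspace_add subspace_scale)
    then have "0 \<le> (v + t *\<^sub>R y) \<bullet> L (v + t *\<^sub>R y)"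
      by (rule nonneg)
    also have "\<dots> = 2 * t * c + t\<^sup>2 * q"
      using v(2) sym[OF v(1) y] linear_add[OF L] linear_scale[OF L]
      by (simp add: c_def q_def inner_add_left inner_add_right algebra_simps power2_eq_square)
    finally show ?thesis .
  qed
  have "0 \<le> q"
    using nonneg[OF y] by (simp add: q_def)
  \<comment> \<open>This \<open>t\<close> is the minimizer of the quadratic, with \<open>q\<close> enlarged to avoid division by zero.\<close>
  define t where "t = - c / (q + 1)"
  then have t: "t * (q + 1) = - c"
    using \<open>0 \<le> q\<close> by simp
  have "(q + 1)\<^sup>2 * (2 * t * c + t\<^sup>2 * q) = 2 * (t * (q + 1)) * (q + 1) * c + (t * (q + 1))\<^sup>2 * q"
    by (simp add: algebra_simps power2_eq_square)
  also have "\<dots> = - (c\<^sup>2 * (q + 2))"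
    unfolding t by (simp add: algebra_simps power2_eq_square)
  finally have "(q + 1)\<^sup>2 * (2 * t * c + t\<^sup>2 * q) = - (c\<^sup>2 * (q + 2))" .
  moreover have "0 \<le> (q + 1)\<^sup>2 * (2 * t * c + t\<^sup>2 * q)"
    using quadratic by simp
  ultimately have "c\<^sup>2 * (q + 2) \<le> 0"
    by linarith
  with \<open>0 \<le> q\<close> have "c\<^sup>2 \<le> 0"
    by (simp add: mult_le_0_iff)
  then show ?thesis
    by (simp add: c_def)
qed

text \<open>
  A maximizer \<open>v\<close> of the Rayleigh quotient is an eigenvector. If \<open>c\<close> is the maximum, then
  \<open>L = c B - B T\<close> is positive semidefinite on \<open>S\<close> and vanishes at \<open>v\<close>, so \<open>L v = B (c v - T v)\<close>
  is orthogonal to \<open>S\<close>, in particular to \<open>c v - T v\<close>. Definiteness gives \<open>T v = c v\<close>.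
\<close>

lemma self_adjoint_eigenvector_exists:
  fixes T B :: "'a::euclidean_space \<Rightarrow> 'a"
  assumes T: "linear T" and B: "linear B" and S: "subspace S" "S \<noteq> {0}"
    and inv: "\<And>x. x \<in> S \<Longrightarrow> T x \<in> S"
    and B_sym: "\<And>x y. x \<bullet> B y = y \<bullet> B x"
    and BT_sym: "\<And>x y. x \<bullet> B (T y) = y \<bullet> B (T x)"
    and pos: "\<And>x. x \<in> S \<Longrightarrow> x \<noteq> 0 \<Longrightarrow> 0 < x \<bullet> B x"
  obtains v c where "v \<in> S" "v \<noteq> 0" "T v = c *\<^sub>R v"
proof -
  define K where "K = S \<inter> sphere 0 1"
  define r where "r x = (x \<bullet> B (T x)) / (x \<bullet> B x)" for x
  have "compact K"
    using S(1) by (simp add: K_def closed_subspace closed_Int_compact)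
  moreover obtain u where u: "u \<in> S" "u \<noteq> 0"
    using S subspace_0 by blast
  then have "u /\<^sub>R norm u \<in> K"
    using S(1) by (simp add: K_def subspace_scale)
  then have "K \<noteq> {}"
    by blast
  moreover have "continuous_on K r"
  proof -
    have "continuous_on K (\<lambda>x. B (T x))" "continuous_on K B"
      using linear_compose[OF T B] B
      by (auto intro!: linear_continuous_on simp: linear_conv_bounded_linear o_def)
    then have "continuous_on K (\<lambda>x. x \<bullet> B (T x))" "continuous_on K (\<lambda>x. x \<bullet> B x)"
      by (auto intro!: continuous_on_inner continuous_on_id)
    moreover have "x \<bullet> B x \<noteq> 0" if "x \<in> K" for x
      using pos[of x] that by (force simp: K_def)
    ultimately show ?thesis
      unfolding r_def by (intro continuous_on_divide) auto
  qed
  ultimately obtain v where v: "v \<in> K" and max: "\<And>x. x \<in> K \<Longrightarrow> r x \<le> r v"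
    using continuous_attains_sup[of K r] by blast
  from v have vS: "v \<in> S" "v \<noteq> 0"
    by (auto simp: K_def)
  define c where "c = r v"
  define L where "L x = c *\<^sub>R B x - B (T x)" for x
  have L: "linear L"
    unfolding L_def using linear_compose[OF T B]
    by (intro linear_compose_sub linear_compose_scale_right B) (simp add: o_def)
  have sym: "x \<bullet> L y = y \<bullet> L x" for x y
    by (simp add: L_def inner_diff_right B_sym[of x y] BT_sym[of x y])
  have L_nonneg: "0 \<le> x \<bullet> L x" if x: "x \<in> S" for x
  proof (cases "x = 0")
    case False
    then have "x /\<^sub>R norm x \<in> K"
      using S(1) x by (simp add: K_def subspace_scale)
    then have "r (x /\<^sub>R norm x) \<le> c"
      unfolding c_def by (rule max)
    moreover have "r (x /\<^sub>R norm x) = r x"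
      using False by (simp add: r_def linear_scale[OF T] linear_scale[OF B] field_simps)
    ultimately have "r x \<le> c"
      by simp
    then show ?thesis
      using pos[OF x False] by (simp add: r_def L_def inner_diff_right field_simps)
  qed simp
  have "v \<bullet> L v = 0"
    using pos[OF vS] by (simp add: L_def inner_diff_right c_def r_def)
  moreover define w where "w = c *\<^sub>R v - T v"
  have w: "w \<in> S"
    using S(1) vS inv by (simp add: w_def subspace_diff subspace_scale)
  ultimately have "w \<bullet> L v = 0"
    using semidefinite_null_vector_orthogonal[OF L S(1) sym L_nonneg] vS by blast
  moreover have "L v = B w"
    by (simp add: L_def w_def linear_diff[OF B] linear_scale[OF B])
  ultimately have "w = 0"
    using pos[OF w] by force
  then show ?thesis
    using vS by (intro that[of v c]) (auto simp: w_def)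
qed

text \<open>
  The spectral theorem, by splitting off one eigenvector at a time: the complement of an
  eigenvector with respect to the form is again invariant and has smaller dimension.
\<close>

lemma definite_subspace_spanned_by_eigenvectors:
  fixes T B :: "'a::euclidean_space \<Rightarrow> 'a"
  assumes T: "linear T" and B: "linear B"
    and B_sym: "\<And>x y. x \<bullet> B y = y \<bullet> B x"
    and BT_sym: "\<And>x y. x \<bullet> B (T y) = y \<bullet> B (T x)"
    and BT_nonneg: "\<And>x. 0 \<le> x \<bullet> B (T x)"
    and "subspace S"
    and "\<And>x. x \<in> S \<Longrightarrow> T x \<in> S"
    and "\<And>x. x \<in> S \<Longrightarrow> x \<noteq> 0 \<Longrightarrow> 0 < x \<bullet> B x"
  shows "S \<subseteq> span {v. \<exists>c\<ge>0. T v = c *\<^sub>R v}"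
  using assms(6-8)
proof (induction "dim S" arbitrary: S rule: less_induct)
  case less
  show ?case
  proof (cases "S = {0}")
    case True
    then show ?thesis
      by (simp add: span_zero)
  next
    case False
    then obtain v c where v: "v \<in> S" "v \<noteq> 0" "T v = c *\<^sub>R v"
      using self_adjoint_eigenvector_exists[OF T B less.prems(1) _ less.prems(2) B_sym BT_sym
          less.prems(3)] by blast
    have v_pos: "0 < v \<bullet> B v"
      using less.prems(3) v by blast
    have "0 \<le> c * (v \<bullet> B v)"
      using BT_nonneg[of v] v(3) by (simp add: linear_scale[OF B])
    then have "0 \<le> c"
      using v_pos by (simp add: zero_le_mult_iff)
    then have v_span: "v \<in> span {v. \<exists>c\<ge>0. T v = c *\<^sub>R v}"
      using v(3) by (intro span_base) blast
    define S' where "S' = {x \<in> S. x \<bullet> B v = 0}"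
    have S': "subspace S'"
      using less.prems(1) by (auto simp: S'_def subspace_def inner_add_left)
    have "v \<notin> S'" "S' \<subseteq> S"
      using v_pos by (auto simp: S'_def)
    with v(1) have "S' \<subset> S"
      by blast
    then have "dim S' < dim S"
      using S' less.prems(1) by (intro dim_psubset) (simp add: span_eq_iff[THEN iffD2])
    moreover have "T x \<in> S'" if "x \<in> S'" for x
    proof -
      have "T x \<bullet> B v = v \<bullet> B (T x)"
        by (rule B_sym)
      also have "\<dots> = x \<bullet> B (T v)"
        by (rule BT_sym)
      also have "\<dots> = 0"
        using that v(3) by (simp add: S'_def linear_scale[OF B])
      finally show ?thesis
        using that less.prems(2) by (simp add: S'_def)
    qed
    ultimately have S'_span: "S' \<subseteq> span {v. \<exists>c\<ge>0. T v = c *\<^sub>R v}"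
      using less.hyps[OF _ S'] less.prems(3) \<open>S' \<subseteq> S\<close> by (meson subsetD)
    show ?thesis
    proof
      fix x assume x: "x \<in> S"
      define k where "k = (x \<bullet> B v) / (v \<bullet> B v)"
      have "x - k *\<^sub>R v \<in> S'"
        using x v(1) v_pos less.prems(1)
        by (simp add: S'_def k_def subspace_diff subspace_scale inner_diff_left)
      then have "(x - k *\<^sub>R v) + k *\<^sub>R v \<in> span {v. \<exists>c\<ge>0. T v = c *\<^sub>R v}"
        using S'_span v_span by (blast intro: span_add span_scale)
      then show "x \<in> span {v. \<exists>c\<ge>0. T v = c *\<^sub>R v}"
        by simp
    qed
  qed
qed


section \<open>Products of positive semidefinite matrices\<close>

lemma sym_psd_inner_commute:
  assumes "sym_psd M"
  shows "x \<bullet> (M *v y) = y \<bullet> (M *v x)"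
  using assms unfolding sym_psd_def
  by (metis dot_lmul_matrix inner_commute vector_transpose_matrix)

lemma sym_psd_mult_eq_0_iff:
  assumes "sym_psd M"
  shows "x \<bullet> (M *v x) = 0 \<longleftrightarrow> M *v x = 0"
proof
  assume "x \<bullet> (M *v x) = 0"
  then have "(M *v x) \<bullet> (M *v x) = 0"
    using semidefinite_null_vector_orthogonal[of "(*v) M" UNIV x "M *v x"] assms
    by (simp add: sym_psd_inner_commute[of M] sym_psd_def matrix_vector_mul_linear)
  then show "M *v x = 0"
    by simp
qed simp

text \<open>
  The kernel inclusion makes the orthogonal complement \<open>W\<close> of \<open>ker B\<close> invariant under \<open>A B\<close>:
  since \<open>A\<close> is symmetric, its range is orthogonal to \<open>ker A\<close> and a fortiori to \<open>ker B\<close>.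
\<close>

lemma psd_product_eigenvectors_span:
  fixes A B :: "real ^ 'n ^ 'n"
  assumes A: "sym_psd A" and B: "sym_psd B"
    and ker: "\<And>x. B *v x = 0 \<Longrightarrow> A *v x = 0"
  shows "span {v. \<exists>c\<ge>0. (A ** B) *v v = c *\<^sub>R v} = UNIV" (is "span ?E = _")
proof -
  define N where "N = {x. B *v x = 0}"
  define W where "W = {x. \<forall>y\<in>N. x \<bullet> y = 0}"
  have N: "subspace N"
    by (auto simp: N_def subspace_def matrix_vector_right_distrib matrix_vector_mult_scaleR)
  have W: "subspace W"
    by (auto simp: W_def subspace_def inner_add_left)
  have AB: "(A ** B) *v x = A *v (B *v x)" for x
    by (simp add: matrix_vector_mul_assoc)
  have form: "x \<bullet> (B *v ((A ** B) *v y)) = (B *v x) \<bullet> (A *v (B *v y))" for x y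
    by (simp add: AB sym_psd_inner_commute[OF B, of x] inner_commute)
  have "W \<subseteq> span ?E"
  proof (rule definite_subspace_spanned_by_eigenvectors[where T = "(*v) (A ** B)" and B = "(*v) B"])
    show "x \<bullet> (B *v y) = y \<bullet> (B *v x)" for x y
      by (rule sym_psd_inner_commute[OF B])
    show "x \<bullet> (B *v ((A ** B) *v y)) = y \<bullet> (B *v ((A ** B) *v x))" for x y
      unfolding form by (rule sym_psd_inner_commute[OF A])
    show "0 \<le> x \<bullet> (B *v ((A ** B) *v x))" for x
      using A unfolding form sym_psd_def by blast
    show "(A ** B) *v x \<in> W" for x
    proof -
      have "(A *v (B *v x)) \<bullet> y = (B *v x) \<bullet> (A *v y)" for y
        unfolding inner_commute[of "A *v (B *v x)" y] by (rule sym_psd_inner_commute[OF A])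
      then show ?thesis
        using ker by (simp add: W_def N_def AB)
    qed
    show "0 < x \<bullet> (B *v x)" if "x \<in> W" "x \<noteq> 0" for x
    proof -
      have "x \<notin> N"
        using that by (auto simp: W_def)
      then have "x \<bullet> (B *v x) \<noteq> 0"
        by (simp add: N_def sym_psd_mult_eq_0_iff[OF B])
      moreover have "0 \<le> x \<bullet> (B *v x)"
        using B by (simp add: sym_psd_def)
      ultimately show ?thesis
        by simp
    qed
  qed (simp_all add: W)
  have "N \<subseteq> span ?E"
    by (auto simp: N_def AB intro!: span_base exI[of _ 0])
  have decomp: "\<exists>n\<in>N. \<exists>w\<in>W. n + w = x" for x
  proof -
    obtain n w where "n \<in> span N" "\<And>y. y \<in> span N \<Longrightarrow> orthogonal w y" "x = n + w"
      using orthogonal_subspace_decomp_exists by blast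
    then show ?thesis
      using N by (auto simp: W_def orthogonal_def span_eq_iff[THEN iffD2])
  qed
  have "x \<in> span ?E" for x
  proof -
    obtain n w where "n \<in> N" "w \<in> W" "n + w = x"
      using decomp by blast
    then show ?thesis
      using \<open>N \<subseteq> span ?E\<close> \<open>W \<subseteq> span ?E\<close> span_add[of n ?E w] by blast
  qed
  then show ?thesis
    by blast
qed


section \<open>Diagonalization and conjugation\<close>

lemma diag_matrix_mult: "diag_matrix d ** diag_matrix e = diag_matrix (\<chi> i. d $ i * e $ i)"
  by (simp add: diag_matrix_def matrix_matrix_mult_def vec_eq_iff if_distrib[of "\<lambda>x. x * _"]
      if_distrib[of "(*) _"] cong: if_cong)

lemma diag_matrix_vector_mult: "diag_matrix d *v x = (\<chi> i. d $ i * x $ i)"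
  by (simp add: diag_matrix_def matrix_vector_mult_def vec_eq_iff if_distrib[of "\<lambda>x. x * _"]
      cong: if_cong)

lemma sym_psd_diag_matrix:
  assumes "\<And>i. 0 \<le> d $ i"
  shows "sym_psd (diag_matrix d)"
  unfolding sym_psd_def
proof (intro conjI allI)
  show "transpose (diag_matrix d) = diag_matrix d"
    by (auto simp: transpose_def diag_matrix_def vec_eq_iff)
  show "0 \<le> x \<bullet> (diag_matrix d *v x)" for x
    using assms
    by (simp add: diag_matrix_vector_mult inner_vec_def mult.left_commute sum_nonneg)
qed

lemma matrix_inv_mult:
  fixes C :: "real ^ 'n ^ 'n"
  assumes "invertible C"
  shows "C ** matrix_inv C = mat 1" "matrix_inv C ** C = mat 1"
proof -
  have "C ** matrix_inv C = mat 1 \<and> matrix_inv C ** C = mat 1"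
    using assms unfolding matrix_inv_def invertible_def by (rule someI_ex)
  then show "C ** matrix_inv C = mat 1" "matrix_inv C ** C = mat 1"
    by auto
qed

lemma similar_matrix_sym:
  assumes "similar_matrix X Y"
  shows "similar_matrix Y X"
proof -
  obtain C where C: "invertible C" "X = C ** Y ** matrix_inv C"
    using assms by (auto simp: similar_matrix_def)
  note inv = matrix_inv_mult[OF C(1)]
  have "invertible (matrix_inv C)"
    using inv by (auto simp: invertible_def)
  moreover have "matrix_inv (matrix_inv C) = C"
    by (metis inv calculation matrix_inv_mult(1) matrix_mul_assoc matrix_mul_lid matrix_mul_rid)
  moreover have "Y = matrix_inv C ** X ** C"
    by (metis C(2) inv(2) matrix_mul_assoc matrix_mul_lid matrix_mul_rid)
  ultimately show ?thesis
    unfolding similar_matrix_def by metis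
qed

text \<open>
  A spanning set of eigenvectors contains a basis, whose members become the columns of the
  conjugating matrix. The predicate \<open>P\<close> carries the sign of the eigenvalues over to the diagonal.
\<close>

lemma diagonalization_if_eigenvectors_span:
  fixes M :: "real ^ 'n ^ 'n"
  assumes "span {v. \<exists>c. P c \<and> M *v v = c *\<^sub>R v} = UNIV" (is "span ?E = _")
  obtains d where "\<And>i. P (d $ i)" "similar_matrix M (diag_matrix d)"
proof -
  obtain E where E: "E \<subseteq> ?E" "independent E" "?E \<subseteq> span E"
    using maximal_independent_subset by blast
  have span_E: "span E = UNIV"
    using assms E(3) span_minimal[of ?E "span E"] by auto
  have "card E = CARD('n)"
    using dim_eq_card[of E UNIV] span_E E(2) by (simp add: dim_UNIV)
  then obtain f :: "'n \<Rightarrow> real ^ 'n" where f: "bij_betw f UNIV E"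
    using finite_same_card_bij[of "UNIV :: 'n set" E] E(2) by (auto dest: finiteI_independent)
  have "f i \<in> ?E" for i
    using f E(1) by (auto simp: bij_betw_def)
  then obtain c where c: "\<And>i. P (c i)" "\<And>i. M *v f i = c i *\<^sub>R f i"
    by simp metis
  define C :: "real ^ 'n ^ 'n" where "C = (\<chi> i j. f j $ i)"
  define d where "d = (\<chi> i. c i)"
  have "column j C = f j" for j
    by (simp add: column_def C_def vec_eq_iff)
  then have "columns C = E"
    using f by (auto simp: columns_def bij_betw_def)
  then have C: "invertible C"
    using span_E by (simp add: invertible_right_inverse matrix_right_invertible_span_columns
        span_vec_eq)
  \<comment> \<open>Column \<open>j\<close> of this identity is the eigenvalue equation for \<open>f j\<close>.\<close>
  have "M ** C = C ** diag_matrix d"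
  proof -
    have "(\<Sum>k\<in>UNIV. M $ i $ k * f j $ k) = f j $ i * c j" for i j
      using c(2)[of j] by (simp add: matrix_vector_mult_def vec_eq_iff mult.commute)
    then show ?thesis
      by (simp add: C_def d_def diag_matrix_def matrix_matrix_mult_def vec_eq_iff
          if_distrib[of "(*) _"] cong: if_cong)
  qed
  then have "M = C ** diag_matrix d ** matrix_inv C"
    by (metis C matrix_inv_mult(1) matrix_mul_assoc matrix_mul_rid)
  then have "similar_matrix M (diag_matrix d)"
    using C unfolding similar_matrix_def by blast
  then show ?thesis
    using c(1) by (intro that[of d]) (auto simp: d_def)
qed

lemma matrix_power_conjugate:
  fixes C Y :: "real ^ 'n ^ 'n"
  assumes "invertible C"
  shows "matrix_power (C ** Y ** matrix_inv C) k = C ** matrix_power Y k ** matrix_inv C"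
proof (induction k)
  case 0
  show ?case
    by (simp add: matrix_inv_mult[OF assms])
next
  case (Suc k)
  have "C ** Y ** matrix_inv C ** (C ** matrix_power Y k ** matrix_inv C)
      = C ** Y ** (matrix_inv C ** C) ** matrix_power Y k ** matrix_inv C"
    by (simp add: matrix_mul_assoc)
  then show ?case
    by (simp add: Suc matrix_inv_mult[OF assms] matrix_mul_assoc)
qed

lemma matrix_mult_add_rdistrib:
  fixes X Y Z :: "real ^ 'n ^ 'n"
  shows "(X + Y) ** Z = X ** Z + Y ** Z"
  by (simp add: matrix_matrix_mult_def vec_eq_iff sum.distrib distrib_right)

lemma conjugate_sum_scaleR:
  fixes C D :: "real ^ 'n ^ 'n"
  shows "C ** (\<Sum>k\<in>I. a k *\<^sub>R Y k) ** D = (\<Sum>k\<in>I. a k *\<^sub>R (C ** Y k ** D))"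
proof -
  have "linear (\<lambda>Z. C ** Z ** D)"
    by (rule linearI)
      (simp_all add: matrix_add_ldistrib matrix_mult_add_rdistrib matrix_scalar_ac
        flip: scalar_matrix_assoc)
  from linear_sum[OF this, of "\<lambda>k. a k *\<^sub>R Y k" I] linear_scale[OF this] show ?thesis
    by simp
qed

lemma similar_poly_matrix:
  assumes "similar_matrix X Y"
  shows "similar_matrix (poly_matrix P X) (poly_matrix P Y)"
proof -
  obtain C where "invertible C" "X = C ** Y ** matrix_inv C"
    using assms by (auto simp: similar_matrix_def)
  then have "poly_matrix P X = C ** poly_matrix P Y ** matrix_inv C"
    by (simp add: poly_matrix_def matrix_power_conjugate conjugate_sum_scaleR)
  with \<open>invertible C\<close> show ?thesis
    unfolding similar_matrix_def by blast
qed

lemma map_matrix_of_real_mult: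
  "map_matrix complex_of_real (X ** Y) = map_matrix complex_of_real X ** map_matrix complex_of_real Y"
  by (simp add: map_matrix_def matrix_matrix_mult_def vec_eq_iff)

lemma complex_eigenvalue_similar:
  fixes X Y :: "real ^ 'n ^ 'n"
  assumes "similar_matrix X Y" "complex_eigenvalue X z"
  shows "complex_eigenvalue Y z"
proof -
  let ?c = "map_matrix complex_of_real"
  obtain C where C: "invertible C" "Y = C ** X ** matrix_inv C"
    using similar_matrix_sym[OF assms(1)] by (auto simp: similar_matrix_def)
  obtain v where v: "v \<noteq> 0" "?c X *v v = z *s v"
    using assms(2) by (auto simp: complex_eigenvalue_def)
  have inv: "?c (matrix_inv C) ** ?c C = mat 1"
    by (simp add: matrix_inv_mult[OF C(1)] flip: map_matrix_of_real_mult)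
      (simp add: map_matrix_def mat_def vec_eq_iff)
  have cancel: "?c (matrix_inv C) *v (?c C *v v) = v"
    by (simp add: matrix_vector_mul_assoc inv)
  have "?c Y *v (?c C *v v) = ?c C *v (?c X *v (?c (matrix_inv C) *v (?c C *v v)))"
    by (simp add: C(2) map_matrix_of_real_mult matrix_vector_mul_assoc matrix_mul_assoc)
  also have "\<dots> = z *s (?c C *v v)"
    by (simp add: cancel v(2) vector_scalar_commute)
  finally have "?c Y *v (?c C *v v) = z *s (?c C *v v)" .
  moreover have "?c C *v v \<noteq> 0"
    using cancel v(1) by force
  ultimately show ?thesis
    unfolding complex_eigenvalue_def by blast
qed

lemma complex_eigenvalue_diag_matrix:
  assumes "complex_eigenvalue (diag_matrix d) z"
  shows "\<exists>i. z = complex_of_real (d $ i)"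
proof -
  obtain v where v: "v \<noteq> 0" "map_matrix complex_of_real (diag_matrix d) *v v = z *s v"
    using assms by (auto simp: complex_eigenvalue_def)
  obtain i where "v $ i \<noteq> 0"
    using v(1) by (auto simp: vec_eq_iff)
  moreover have "complex_of_real (d $ i) * v $ i = z * v $ i"
    using v(2)
    by (simp add: diag_matrix_def matrix_vector_mult_def vec_eq_iff if_distrib[of complex_of_real]
        if_distrib[of "\<lambda>x. x * _"] cong: if_cong)
  ultimately show ?thesis
    by auto
qed

lemma invertible_identity_plus_scaled:
  fixes M :: "real ^ 'n ^ 'n"
  assumes "similar_matrix M (diag_matrix d)" "\<And>i. 0 \<le> d $ i" "0 < \<tau>"
  shows "invertible (mat 1 + \<tau> *\<^sub>R M)"
proof -
  obtain C where C: "invertible C" "M = C ** diag_matrix d ** matrix_inv C"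
    using assms(1) by (auto simp: similar_matrix_def)
  define D where "D = diag_matrix (\<chi> i. 1 + \<tau> * d $ i)"
  have D_eq: "D = mat 1 + \<tau> *\<^sub>R diag_matrix d"
    by (simp add: D_def diag_matrix_def mat_def vec_eq_iff)
  have "1 + \<tau> * d $ i \<noteq> 0" for i
    using assms(2)[of i] assms(3) by (smt (verit) mult_nonneg_nonneg)
  then have "D ** diag_matrix (\<chi> i. 1 / (1 + \<tau> * d $ i)) = mat 1"
    unfolding D_def diag_matrix_mult by (simp add: diag_matrix_def mat_def vec_eq_iff)
  then have "invertible D"
    using invertible_right_inverse by blast
  moreover have "invertible (matrix_inv C)"
    using matrix_inv_mult[OF C(1)] by (auto simp: invertible_def)
  ultimately have "invertible (C ** D ** matrix_inv C)"
    using C(1) by (intro invertible_mult)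
  moreover have "C ** D ** matrix_inv C = mat 1 + \<tau> *\<^sub>R M"
    by (simp add: D_eq C(2) matrix_add_ldistrib matrix_mult_add_rdistrib matrix_scalar_ac
        matrix_inv_mult[OF C(1)] flip: scalar_matrix_assoc)
  ultimately show ?thesis
    by simp
qed


section \<open>The linearized Cahn--Hilliard step\<close>

text \<open>
  The identity added by the convex splitting cancels the \<open>- I\<close> in \<open>J\<^sub>n\<close>; what remains is
  \<open>3 diag ((y\<^sup>n\<^sub>i)\<^sup>2) + \<epsilon>\<^sup>2 A\<close>.
\<close>

lemma
  fixes A :: "real ^ 'n ^ 'n" and y :: "real ^ 'n"
  assumes A: "sym_psd A" and "\<epsilon> > 0"
  defines "B \<equiv> J_mat y + \<epsilon>\<^sup>2 *\<^sub>R A + mat 1"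
  shows sym_psd_splitting_factor: "sym_psd B"
    and ker_splitting_factor: "\<And>x. B *v x = 0 \<Longrightarrow> A *v x = 0"
proof -
  define D where "D = diag_matrix (\<chi> i. (y $ i)\<^sup>2)"
  have D: "sym_psd D"
    unfolding D_def by (rule sym_psd_diag_matrix) simp
  have B: "B = 3 *\<^sub>R D + \<epsilon>\<^sup>2 *\<^sub>R A"
    by (simp add: B_def J_mat_def D_def)
  have form: "x \<bullet> (B *v x) = 3 * (x \<bullet> (D *v x)) + \<epsilon>\<^sup>2 * (x \<bullet> (A *v x))" for x
    by (simp add: B matrix_vector_mult_add_rdistrib inner_add_right flip: scaleR_matrix_vector_assoc)
  have nonneg: "0 \<le> x \<bullet> (D *v x)" "0 \<le> x \<bullet> (A *v x)" for x
    using A D by (simp_all add: sym_psd_def)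
  have "transpose B = B"
    using A D by (simp add: B sym_psd_def transpose_def vec_eq_iff)
  then show "sym_psd B"
    using nonneg by (simp add: sym_psd_def form)
  show "A *v x = 0" if "B *v x = 0" for x
  proof -
    have "3 * (x \<bullet> (D *v x)) + \<epsilon>\<^sup>2 * (x \<bullet> (A *v x)) = 0"
      using form[of x] that by simp
    moreover have "0 \<le> \<epsilon>\<^sup>2 * (x \<bullet> (A *v x))"
      using nonneg by simp
    ultimately have "\<epsilon>\<^sup>2 * (x \<bullet> (A *v x)) = 0"
      using nonneg(1)[of x] by linarith
    then show ?thesis
      using \<open>\<epsilon> > 0\<close> sym_psd_mult_eq_0_iff[OF A] by simp
  qed
qed

lemma A_hat_similar_nonneg_diag:
  fixes A :: "real ^ 'n ^ 'n"
  assumes "sym_psd A" "\<epsilon> > 0"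
  obtains d where "\<And>i. 0 \<le> d $ i" "similar_matrix (A_hat A \<epsilon> y) (diag_matrix d)"
proof -
  have "span {v. \<exists>c\<ge>0. A_hat A \<epsilon> y *v v = c *\<^sub>R v} = UNIV"
    unfolding A_hat_def
    by (intro psd_product_eigenvectors_span sym_psd_splitting_factor assms)
      (rule ker_splitting_factor[OF assms])
  then show ?thesis
    by (rule diagonalization_if_eigenvectors_span) (rule that)
qed

text \<open>
  Multiplied by \<open>\<tau>\<close>, the scheme reads \<open>(I + \<tau> M) y1 = y + \<tau> g\<close>.
\<close>

lemma linearized_euler_step_solvable:
  fixes M :: "real ^ 'n ^ 'n"
  assumes "invertible (mat 1 + \<tau> *\<^sub>R M)" "0 < \<tau>"
  shows "\<exists>y1. (1 / \<tau>) *\<^sub>R (y1 - y) = - (M *v y1) + g"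
proof -
  define y1 where "y1 = matrix_inv (mat 1 + \<tau> *\<^sub>R M) *v (y + \<tau> *\<^sub>R g)"
  have "(mat 1 + \<tau> *\<^sub>R M) *v y1 = y + \<tau> *\<^sub>R g"
    unfolding y1_def by (simp add: matrix_vector_mul_assoc matrix_inv_mult[OF assms(1)])
  then have "y1 + \<tau> *\<^sub>R (M *v y1) = y + \<tau> *\<^sub>R g"
    by (simp add: matrix_vector_mult_add_rdistrib flip: scaleR_matrix_vector_assoc)
  then have "y1 - y = \<tau> *\<^sub>R (- (M *v y1) + g)"
    by (simp add: algebra_simps)
  then have "(1 / \<tau>) *\<^sub>R (y1 - y) = - (M *v y1) + g"
    using assms(2) by simp
  then show ?thesis
    by blast
qed

theorem proposition2:
  fixes A :: "real ^ 'n ^ 'n" and \<epsilon> :: real and yn :: "real ^ 'n"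
  assumes "sym_psd A" and "\<epsilon> > 0"
  shows "diagonalizable (A_hat A \<epsilon> yn)
    \<and> (\<forall>z. complex_eigenvalue (A_hat A \<epsilon> yn) z \<longrightarrow> z \<in> \<real> \<and> 0 \<le> Re z)
    \<and> (\<exists>At :: real ^ 'n ^ 'n. sym_psd At \<and> similar_matrix At (A_hat A \<epsilon> yn)
        \<and> (\<forall>\<tau> > 0. \<forall>\<beta>. lim_ordering (lim_p \<tau> (A_hat A \<epsilon> yn)) \<beta> \<longrightarrow>
             (let P = lim_poly \<tau> (A_hat A \<epsilon> yn) \<beta>
              in similar_matrix (poly_matrix P (A_hat A \<epsilon> yn)) (poly_matrix P At))))
    \<and> (\<forall>\<tau> > 0. invertible (mat 1 + \<tau> *\<^sub>R A_hat A \<epsilon> yn)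
        \<and> (\<exists>y1 :: real ^ 'n. (1 / \<tau>) *\<^sub>R (y1 - yn) = - (A_hat A \<epsilon> yn *v y1) + g_hat A yn))"
proof -
  obtain d where d: "\<And>i. 0 \<le> d $ i" and sim: "similar_matrix (A_hat A \<epsilon> yn) (diag_matrix d)"
    using A_hat_similar_nonneg_diag[OF assms] by blast
  have "diagonalizable (A_hat A \<epsilon> yn)"
    using sim by (auto simp: diagonalizable_def)
  moreover have "z \<in> \<real> \<and> 0 \<le> Re z" if "complex_eigenvalue (A_hat A \<epsilon> yn) z" for z
    using complex_eigenvalue_diag_matrix[OF complex_eigenvalue_similar[OF sim that]] d by auto
  moreover have "\<exists>At :: real ^ 'n ^ 'n. sym_psd At \<and> similar_matrix At (A_hat A \<epsilon> yn)
      \<and> (\<forall>\<tau> > 0. \<forall>\<beta>. lim_ordering (lim_p \<tau> (A_hat A \<epsilon> yn)) \<beta> \<longrightarrow>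
           (let P = lim_poly \<tau> (A_hat A \<epsilon> yn) \<beta>
            in similar_matrix (poly_matrix P (A_hat A \<epsilon> yn)) (poly_matrix P At)))"
    using sym_psd_diag_matrix[OF d] similar_matrix_sym[OF sim] similar_poly_matrix[OF sim]
    unfolding Let_def by blast
  moreover have inv: "invertible (mat 1 + \<tau> *\<^sub>R A_hat A \<epsilon> yn)" if "0 < \<tau>" for \<tau>
    using invertible_identity_plus_scaled[OF sim d that] .
  ultimately show ?thesis
    using linearized_euler_step_solvable[OF inv] by blast
qed

end
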